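(* Let $(\mu_t)_{t\in[0,1]}$ be an admissible $\mathrm{HK}$ geodesic with tangent field $(\nabla\varphi_t,\varphi_t)$ and let $(\lambda_t)_{t\in[0,1]}$ be its deterministic isometric lift. Write $\mathcal L_t=\mathcal L_{\mu_t,\lambda_t}$, $\mathcal P_t=\mathcal P_{\lambda_t}$ and $V_t=\mathcal L_t(\nabla\varphi_t,\varphi_t)$. For any HK tangent field $\mathbf u_t=(\nabla\psi_t,\psi_t)$ along $(\mu_t)$ with $\psi_t\in C^{2,1}(\Omega\times(0,1))$ (twice continuously differentiable in space, once in time), define the pullback connection $$\widetilde\nabla_{(\nabla\varphi_t,\varphi_t)}\mathbf u_t:=(\Pi_{\mu_t}\circ\mathcal P_t)\left(\mathbf D_t^{W_2}(\mathcal L_t\mathbf u_t)\right),\qquad \mathbf D_t^{W_2}Z_t=\partial_tZ_t+\nabla^{\mathfrak C}_{V_t}Z_t,$$ where $\mathbf D_t^{W_2}$ is the Wasserstein total derivative on the cone. Then $$\widetilde\nabla_{(\nabla\varphi_t,\varphi_t)}\mathbf u_t=\nabla^{\mathrm{HK}}_{(\nabla\varphi_t,\varphi_t)}\mathbf u_t.$$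
   Context: Setting: $\Gamma\Subset U\Subset\Omega^\circ$, $\Omega\subset\mathbb R^d$ compact, $\operatorname{diam}\Omega<\pi/2$, $U$ open. $\mathfrak M_+^\Gamma(\Omega)$: finite nonnegative Radon measures on $\Omega$ supported in $\Gamma$. HK tangent space: $T_\mu\mathfrak M_+^\Gamma=\overline{\{(\nabla\varphi,\varphi):\varphi\in C_c^\infty(U)\}}^{L^2(\mu)\times L^2(\mu)}$ with inner product $\int\langle v_1,v_2\rangle+4\beta_1\beta_2\,d\mu$; $\Pi_\mu$ is the orthogonal projection of $L^2(\mu;\mathbb R^d)\times L^2(\mu)$ onto it. HK covariant derivative along $\mu_t$ with tangent field $(\nabla\varphi_t,\varphi_t)$: $$\nabla^{\mathrm{HK}}_{(\nabla\varphi_t,\varphi_t)}\binom{v_t}{\beta_t}=\Pi_{\mu_t}\begin{pmatrix}\partial_tv_t+\nabla v_t\cdot\nabla\varphi_t+2\varphi_tv_t+2\beta_t\nabla\varphi_t\\ \partial_t\beta_t+\tfrac12\langle\nabla\beta_t,\nabla\varphi_t\rangle+2\varphi_t\beta_t\end{pmatrix}.$$ Continuity-reaction equation (distributional): $\int_0^1\int_\Omega(\partial_t\phi+\langle\nabla\phi,v_t\rangle+4\beta_t\phi)d\mu_tdt=0$ for $\phi\in C^1_c((0,1)\times\Omega)$. $\mathrm{HK}^2(\mu_0,\mu_1)$ is the infimum of $\int_0^1(\|v_t\|^2_{L^2(\mu_t)}+4\|\beta_t\|^2_{L^2(\mu_t)})dt$ over its weakly continuous solutions joining $\mu_0,\mu_1$.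 Admissible HK geodesic: a constant-speed HK geodesic $(\mu_t)$ between two measures of $\mathfrak M_+^\Gamma(\Omega)$ having Lebesgue densities, with tangent velocity $(v_t,\beta_t)=(\nabla\varphi_t,\varphi_t)$ solving the continuity-reaction equation, such that (A.1) for all $0\le t_1<t_2\le1$ the map $T$ inducing the optimal logarithmic-entropy-transport plan $\pi$ of $(\mu_{t_1},\mu_{t_2})$ is $\pi_0$-a.e. injective, where $\pi$ minimizes $\int F(\frac{d\pi_0}{d\mu_{t_1}})d\mu_{t_1}+\int F(\frac{d\pi_1}{d\mu_{t_2}})d\mu_{t_2}+\int-2\log\cos\|x_0-x_1\|\,d\pi$, $F(\rho)=\rho\log\rho-\rho+1$, with $\pi_0,\pi_1$ its marginals; (A.2) $\beta_{\min}\le\beta_t\le\beta_{\max}$ with finite constants, $\sup_t(\|v_t\|_{W^{1,\infty}(U)}+\|\beta_t\|_{W^{1,\infty}(U)})\le M<\infty$, $\int_0^1\|v_t\|^2_{L^2(\mu_t)}+\|\beta_t\|^2_{L^2(\mu_t)}dt<\infty$. Deterministic isometric lift: with $X_t$ the flow of $v_t$ ($\partial_tX_t=v_t(X_t)$, $X_0=\mathrm{id}$), $\eta_t=(X_t)_\#\mu_0$ and $r_t(X_t(x))=\exp(2\int_0^t\beta_s(X_s(x))ds)$, set $\lambda_t=(x\mapsto(x,r_t(x)))_\#\eta_t$, a measure on the cone over $\Omega$. Cone: points $(x,r)$, $x\in\Omega$, $r>0$; tangent vectors $(a,b)=a+b\partial_r$, inner product $r^2\langle a,a'\rangle+bb'$.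 Its Levi-Civita connection $\nabla^{\mathfrak C}$ is, for $W=a+b\partial_r$, $Z=c+d\,\partial_r$, $\nabla^{\mathfrak C}_WZ=\left(D_xc\cdot a+b\,\partial_rc+\tfrac br c+\tfrac dr a\right)+\left(\langle a,\nabla_xd\rangle+b\,\partial_rd-r\langle a,c\rangle\right)\partial_r$. Tangent lift: $\mathcal L_{\mu,\lambda}(v,\beta)(x,r)=(v(x),2\beta(x)r)$. Tangent projection for $\lambda=(x\mapsto(x,r(x)))_\#\eta$: $\mathcal P_\lambda[a+b\partial_r](x)=\left(a(x,r(x)),\frac{b(x,r(x))}{2r(x)}\right)$. *)

theory Defs
  imports "HOL-Analysis.Analysis"
begin

section \<open>Differential calculus on Euclidean space\<close>

definition grad :: "('a::euclidean_space \<Rightarrow> real) \<Rightarrow> 'a \<Rightarrow> 'a" where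
  "grad f x = (THE D. GDERIV f x :> D)"

text \<open>\<open>Ck_on k S\<close> is the class of \<open>C\<^sup>k\<close> functions on an open set \<open>S\<close>.\<close>

primrec Ck_on :: "nat \<Rightarrow> 'a::euclidean_space set \<Rightarrow> ('a \<Rightarrow> 'b::real_normed_vector) \<Rightarrow> bool" where
  "Ck_on 0 S f \<longleftrightarrow> continuous_on S f"
| "Ck_on (Suc k) S f \<longleftrightarrow> (\<forall>x\<in>S. f differentiable (at x)) \<and>
     (\<forall>i\<in>Basis. Ck_on k S (\<lambda>x. frechet_derivative f (at x) i))"

definition test_functions :: "'a::euclidean_space set \<Rightarrow> ('a \<Rightarrow> real) set" where
  "test_functions U = {\<zeta>. (\<forall>k. Ck_on k UNIV \<zeta>) \<and>
     compact (closure {x. \<zeta> x \<noteq> 0}) \<and> closure {x. \<zeta> x \<noteq> 0} \<subseteq> U}"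

text \<open>\<open>C\<^sup>2\<^sup>,\<^sup>1(\<Omega> \<times> (0,1))\<close> for a closed set \<open>\<Omega>\<close>: twice continuously differentiable in space and once
  in time on an open neighbourhood of \<open>(0,1) \<times> \<Omega>\<close>. No mixed derivative is required to exist.\<close>

definition C21_on :: "'a::euclidean_space set \<Rightarrow> (real \<Rightarrow> 'a \<Rightarrow> real) \<Rightarrow> bool" where
  "C21_on \<Omega> \<psi> \<longleftrightarrow> (\<exists>N. open N \<and> {0<..<1} \<times> \<Omega> \<subseteq> N \<and>
     (\<forall>(t, x)\<in>N. \<psi> t differentiable (at x) \<and>
        (\<forall>i\<in>Basis. (\<lambda>y. frechet_derivative (\<psi> t) (at y) i) differentiable (at x)) \<and>
        (\<lambda>s. \<psi> s x) differentiable (at t)) \<and>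
     continuous_on N (\<lambda>(t, x). \<psi> t x) \<and>
     (\<forall>i\<in>Basis. continuous_on N (\<lambda>(t, x). frechet_derivative (\<psi> t) (at x) i)) \<and>
     (\<forall>i\<in>Basis. \<forall>j\<in>Basis. continuous_on N (\<lambda>(t, x).
        frechet_derivative (\<lambda>y. frechet_derivative (\<psi> t) (at y) i) (at x) j)) \<and>
     continuous_on N (\<lambda>(t, x). vector_derivative (\<lambda>s. \<psi> s x) (at t)))"

text \<open>\<open>G i\<close> is the weak partial derivative of \<open>f\<close> on \<open>U\<close> in direction \<open>i\<close>.\<close>

definition weak_derivative_on ::
  "'a::euclidean_space set \<Rightarrow> ('a \<Rightarrow> 'b::euclidean_space) \<Rightarrow> ('a \<Rightarrow> 'a \<Rightarrow> 'b) \<Rightarrow> bool" where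
  "weak_derivative_on U f G \<longleftrightarrow> (\<forall>i\<in>Basis. G i \<in> borel_measurable (restrict_space lborel U) \<and>
     (\<forall>\<zeta>\<in>test_functions U.
        (\<integral>x. frechet_derivative \<zeta> (at x) i *\<^sub>R f x \<partial>lborel) = - (\<integral>x. \<zeta> x *\<^sub>R G i x \<partial>lborel)))"

text \<open>\<open>f \<in> W\<^sup>1\<^sup>,\<^sup>\<infinity>(U)\<close> with norm (sup norm of \<open>f\<close> plus sup norm of the weak differential) at most \<open>M\<close>.\<close>

definition W1inf_norm_le :: "'a::euclidean_space set \<Rightarrow> ('a \<Rightarrow> 'b::euclidean_space) \<Rightarrow> real \<Rightarrow> bool" where
  "W1inf_norm_le U f M \<longleftrightarrow> f \<in> borel_measurable (restrict_space lborel U) \<and>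
     (\<exists>G A B. weak_derivative_on U f G \<and> A + B \<le> M \<and>
        (AE x in lborel. x \<in> U \<longrightarrow> norm (f x) \<le> A) \<and>
        (AE x in lborel. x \<in> U \<longrightarrow> sqrt (\<Sum>i\<in>Basis. (norm (G i x))\<^sup>2) \<le> B))"


section \<open>Measures\<close>

definition HK_setting :: "'a::euclidean_space set \<Rightarrow> 'a set \<Rightarrow> 'a set \<Rightarrow> bool" where
  "HK_setting \<Omega> U \<Gamma> \<longleftrightarrow> compact \<Omega> \<and> diameter \<Omega> < pi / 2 \<and> open U \<and>
     compact (closure U) \<and> closure U \<subseteq> interior \<Omega> \<and>
     compact (closure \<Gamma>) \<and> closure \<Gamma> \<subseteq> U"

text \<open>Measures on a closed set \<open>\<Omega>\<close> are represented by Borel measures on the whole space that are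
  concentrated on \<open>\<Omega>\<close>.\<close>

definition finite_measures :: "'a::topological_space set \<Rightarrow> 'a measure set" where
  "finite_measures \<Omega> = {\<mu>. sets \<mu> = sets borel \<and> finite_measure \<mu> \<and> (AE x in \<mu>. x \<in> \<Omega>)}"

definition measure_support :: "'a::topological_space measure \<Rightarrow> 'a set" where
  "measure_support \<mu> = {x. \<forall>V. open V \<and> x \<in> V \<longrightarrow> emeasure \<mu> V > 0}"

definition finite_measures_in :: "'a::topological_space set \<Rightarrow> 'a set \<Rightarrow> 'a measure set" where
  "finite_measures_in \<Gamma> \<Omega> = {\<mu> \<in> finite_measures \<Omega>. measure_support \<mu> \<subseteq> \<Gamma>}"

definition has_Lebesgue_density :: "'a::euclidean_space measure \<Rightarrow> bool" where
  "has_Lebesgue_density \<mu> \<longleftrightarrow> (\<exists>f\<in>borel_measurable borel. \<mu> = density lborel f)"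


section \<open>The tangent space of the Hellinger--Kantorovich metric\<close>

text \<open>A pair \<open>(v, \<beta>)\<close> is a function into \<open>'a \<times> real\<close>, representing its class modulo \<open>\<mu>\<close>-null sets.
  Integrals are taken with respect to the completion of \<open>\<mu>\<close>, so that membership in \<open>HK_L2 \<mu>\<close> and
  \<open>HK_inner \<mu>\<close> depend on the class only.\<close>

type_synonym 'a hk_field = "'a \<Rightarrow> 'a \<times> real"

definition grad_field :: "('a::euclidean_space \<Rightarrow> real) \<Rightarrow> 'a hk_field" where
  "grad_field \<phi> x = (grad \<phi> x, \<phi> x)"

definition HK_L2 :: "'a::euclidean_space measure \<Rightarrow> 'a hk_field set" where
  "HK_L2 \<mu> = {u \<in> borel_measurable (completion \<mu>).
     integrable (completion \<mu>) (\<lambda>x. (norm (fst (u x)))\<^sup>2) \<and>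
     integrable (completion \<mu>) (\<lambda>x. (snd (u x))\<^sup>2)}"

definition HK_inner :: "'a::euclidean_space measure \<Rightarrow> 'a hk_field \<Rightarrow> 'a hk_field \<Rightarrow> real" where
  "HK_inner \<mu> u w = (\<integral>x. fst (u x) \<bullet> fst (w x) + 4 * snd (u x) * snd (w x) \<partial>completion \<mu>)"

definition HK_tangent :: "'a::euclidean_space set \<Rightarrow> 'a measure \<Rightarrow> 'a hk_field set" where
  "HK_tangent U \<mu> = {u \<in> HK_L2 \<mu>. \<forall>\<epsilon>>0. \<exists>\<zeta>\<in>test_functions U.
     HK_inner \<mu> (\<lambda>x. u x - grad_field \<zeta> x) (\<lambda>x. u x - grad_field \<zeta> x) < \<epsilon>}"

text \<open>The projection of \<open>f \<in> HK_L2 \<mu>\<close> is determined up to \<open>\<mu>\<close>-null sets; \<open>HK_proj\<close> picks a representative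
  that depends on the class of \<open>f\<close> only.\<close>

definition HK_projection_of ::
  "'a::euclidean_space set \<Rightarrow> 'a measure \<Rightarrow> 'a hk_field \<Rightarrow> 'a hk_field \<Rightarrow> bool" where
  "HK_projection_of U \<mu> f w \<longleftrightarrow> f \<in> HK_L2 \<mu> \<and> w \<in> HK_tangent U \<mu> \<and>
     (\<forall>z\<in>HK_tangent U \<mu>. HK_inner \<mu> (\<lambda>x. f x - w x) z = 0)"

definition HK_proj :: "'a::euclidean_space set \<Rightarrow> 'a measure \<Rightarrow> 'a hk_field \<Rightarrow> 'a hk_field" where
  "HK_proj U \<mu> f = (SOME w. HK_projection_of U \<mu> f w)"

definition HK_cov_deriv ::
  "'a::euclidean_space set \<Rightarrow> (real \<Rightarrow> 'a measure) \<Rightarrow> (real \<Rightarrow> 'a \<Rightarrow> real) \<Rightarrow>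
   (real \<Rightarrow> 'a hk_field) \<Rightarrow> real \<Rightarrow> 'a hk_field" where
  "HK_cov_deriv U \<mu> \<phi> u t =
    (let v = (\<lambda>s x. fst (u s x)); \<beta> = (\<lambda>s x. snd (u s x)) in
     HK_proj U (\<mu> t) (\<lambda>x.
       (vector_derivative (\<lambda>s. v s x) (at t) + frechet_derivative (v t) (at x) (grad (\<phi> t) x)
          + (2 * \<phi> t x) *\<^sub>R v t x + (2 * \<beta> t x) *\<^sub>R grad (\<phi> t) x,
        vector_derivative (\<lambda>s. \<beta> s x) (at t) + (1 / 2) * (grad (\<beta> t) x \<bullet> grad (\<phi> t) x)
          + 2 * \<phi> t x * \<beta> t x)))"


section \<open>The Hellinger--Kantorovich distance and its geodesics\<close>

definition weakly_continuous :: "(real \<Rightarrow> 'a::euclidean_space measure) \<Rightarrow> bool" where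
  "weakly_continuous \<mu> \<longleftrightarrow>
     (\<forall>f::'a \<Rightarrow> real. continuous_on UNIV f \<longrightarrow> continuous_on {0..1} (\<lambda>t. \<integral>x. f x \<partial>\<mu> t))"

text \<open>Weakly continuous solutions of the continuity-reaction equation. As \<open>\<Omega>\<close> is compact, the test
  functions in \<open>C\<^sup>1\<^sub>c((0,1) \<times> \<Omega>)\<close> need not vanish on the boundary of \<open>\<Omega>\<close>; they are taken as restrictions
  of \<open>C\<^sup>1\<close> functions on the whole space. The \<open>L\<^sup>1\<close> bound makes the double integral meaningful; it
  is implied by finite energy.\<close>

definition cont_reaction_solution ::
  "'a::euclidean_space set \<Rightarrow> (real \<Rightarrow> 'a measure) \<Rightarrow> (real \<Rightarrow> 'a \<Rightarrow> 'a) \<Rightarrow> (real \<Rightarrow> 'a \<Rightarrow> real) \<Rightarrow> bool" where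
  "cont_reaction_solution \<Omega> \<mu> v \<beta> \<longleftrightarrow>
     (\<forall>t\<in>{0..1}. \<mu> t \<in> finite_measures \<Omega>) \<and> weakly_continuous \<mu> \<and>
     (\<lambda>(t, x). v t x) \<in> borel_measurable (restrict_space borel ({0<..<1} \<times> \<Omega>)) \<and>
     (\<lambda>(t, x). \<beta> t x) \<in> borel_measurable (restrict_space borel ({0<..<1} \<times> \<Omega>)) \<and>
     (\<integral>\<^sup>+t\<in>{0<..<1}. (\<integral>\<^sup>+x\<in>\<Omega>. ennreal (norm (v t x) + \<bar>\<beta> t x\<bar>) \<partial>\<mu> t) \<partial>lborel) < \<infinity> \<and>
     (\<forall>\<zeta> :: real \<times> 'a \<Rightarrow> real. Ck_on 1 UNIV \<zeta> \<and>
        (\<exists>a b. 0 < a \<and> b < 1 \<and> (\<forall>t x. t \<notin> {a..b} \<longrightarrow> \<zeta> (t, x) = 0)) \<longrightarrow>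
        (LINT t:{0<..<1}|lborel. (LINT x:\<Omega>|\<mu> t. vector_derivative (\<lambda>s. \<zeta> (s, x)) (at t)
           + grad (\<lambda>y. \<zeta> (t, y)) x \<bullet> v t x + 4 * \<beta> t x * \<zeta> (t, x))) = 0)"

definition HK_energy ::
  "'a::euclidean_space set \<Rightarrow> (real \<Rightarrow> 'a measure) \<Rightarrow> (real \<Rightarrow> 'a \<Rightarrow> 'a) \<Rightarrow> (real \<Rightarrow> 'a \<Rightarrow> real) \<Rightarrow> ennreal" where
  "HK_energy \<Omega> \<mu> v \<beta> =
     (\<integral>\<^sup>+t\<in>{0<..<1}. (\<integral>\<^sup>+x\<in>\<Omega>. ennreal ((norm (v t x))\<^sup>2 + 4 * (\<beta> t x)\<^sup>2) \<partial>\<mu> t) \<partial>lborel)"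

definition HK_sq :: "'a::euclidean_space set \<Rightarrow> 'a measure \<Rightarrow> 'a measure \<Rightarrow> ennreal" where
  "HK_sq \<Omega> \<mu>0 \<mu>1 = Inf {HK_energy \<Omega> \<mu> v \<beta> | \<mu> v \<beta>.
     cont_reaction_solution \<Omega> \<mu> v \<beta> \<and> \<mu> 0 = \<mu>0 \<and> \<mu> 1 = \<mu>1}"

definition HK :: "'a::euclidean_space set \<Rightarrow> 'a measure \<Rightarrow> 'a measure \<Rightarrow> real" where
  "HK \<Omega> \<mu>0 \<mu>1 = sqrt (enn2real (HK_sq \<Omega> \<mu>0 \<mu>1))"

definition const_speed_HK_geodesic ::
  "'a::euclidean_space set \<Rightarrow> (real \<Rightarrow> 'a measure) \<Rightarrow> bool" where
  "const_speed_HK_geodesic \<Omega> \<mu> \<longleftrightarrow> (\<forall>t\<in>{0..1}. \<mu> t \<in> finite_measures \<Omega>) \<and>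
     (\<forall>s\<in>{0..1}. \<forall>t\<in>{0..1}. HK \<Omega> (\<mu> s) (\<mu> t) = \<bar>s - t\<bar> * HK \<Omega> (\<mu> 0) (\<mu> 1))"


section \<open>Logarithmic entropy transport\<close>

definition entropy_fun :: "real \<Rightarrow> real" where
  "entropy_fun \<rho> = \<rho> * ln \<rho> - \<rho> + 1"

text \<open>The value is infinite without absolute continuity, as \<open>entropy_fun\<close> grows superlinearly.\<close>

definition rel_entropy :: "'a measure \<Rightarrow> 'a measure \<Rightarrow> ennreal" where
  "rel_entropy \<nu> \<mu> = (if absolutely_continuous \<mu> \<nu>
     then \<integral>\<^sup>+x. ennreal (entropy_fun (enn2real (RN_deriv \<mu> \<nu> x))) \<partial>\<mu> else \<infinity>)"

definition LET_functional ::
  "'a::euclidean_space measure \<Rightarrow> 'a measure \<Rightarrow> ('a \<times> 'a) measure \<Rightarrow> ennreal" where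
  "LET_functional \<mu>0 \<mu>1 \<pi> =
     rel_entropy (distr \<pi> borel fst) \<mu>0 + rel_entropy (distr \<pi> borel snd) \<mu>1
     + (\<integral>\<^sup>+(x0, x1). ennreal (- 2 * ln (cos (norm (x0 - x1)))) \<partial>\<pi>)"

definition LET_optimal ::
  "'a::euclidean_space set \<Rightarrow> 'a measure \<Rightarrow> 'a measure \<Rightarrow> ('a \<times> 'a) measure \<Rightarrow> bool" where
  "LET_optimal \<Omega> \<mu>0 \<mu>1 \<pi> \<longleftrightarrow> \<pi> \<in> finite_measures (\<Omega> \<times> \<Omega>) \<and>
     (\<forall>\<pi>'\<in>finite_measures (\<Omega> \<times> \<Omega>). LET_functional \<mu>0 \<mu>1 \<pi> \<le> LET_functional \<mu>0 \<mu>1 \<pi>')"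

definition LET_map_injective ::
  "'a::euclidean_space set \<Rightarrow> 'a measure \<Rightarrow> 'a measure \<Rightarrow> bool" where
  "LET_map_injective \<Omega> \<mu>0 \<mu>1 \<longleftrightarrow> (\<exists>\<pi> T. LET_optimal \<Omega> \<mu>0 \<mu>1 \<pi> \<and> T \<in> borel_measurable borel \<and>
     \<pi> = distr (distr \<pi> borel fst) borel (\<lambda>x. (x, T x)) \<and>
     (\<exists>N\<in>null_sets (distr \<pi> borel fst). inj_on T (- N)))"


section \<open>Admissible geodesics\<close>

definition admissible_HK_geodesic ::
  "'a::euclidean_space set \<Rightarrow> 'a set \<Rightarrow> 'a set \<Rightarrow> (real \<Rightarrow> 'a measure) \<Rightarrow> (real \<Rightarrow> 'a \<Rightarrow> real) \<Rightarrow> bool" where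
  "admissible_HK_geodesic \<Omega> U \<Gamma> \<mu> \<phi> \<longleftrightarrow>
     const_speed_HK_geodesic \<Omega> \<mu> \<and>
     (\<forall>t\<in>{0, 1}. \<mu> t \<in> finite_measures_in \<Gamma> \<Omega> \<and> has_Lebesgue_density (\<mu> t)) \<and>
     (\<forall>t\<in>{0<..<1}. (\<forall>x\<in>U. \<phi> t differentiable (at x)) \<and> (AE x in \<mu> t. \<phi> t differentiable (at x))) \<and>
     cont_reaction_solution \<Omega> \<mu> (\<lambda>t. grad (\<phi> t)) \<phi> \<and>
     (AE t in lborel. t \<in> {0<..<1} \<longrightarrow> grad_field (\<phi> t) \<in> HK_tangent U (\<mu> t)) \<and>
     (\<forall>t1 t2. 0 \<le> t1 \<and> t1 < t2 \<and> t2 \<le> 1 \<longrightarrow> LET_map_injective \<Omega> (\<mu> t1) (\<mu> t2)) \<and>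
     (\<exists>\<beta>_min \<beta>_max. \<forall>t\<in>{0<..<1}. \<forall>x\<in>U. \<beta>_min \<le> \<phi> t x \<and> \<phi> t x \<le> \<beta>_max) \<and>
     (\<exists>M. \<forall>t\<in>{0<..<1}. \<exists>A B. W1inf_norm_le U (grad (\<phi> t)) A \<and> W1inf_norm_le U (\<phi> t) B \<and> A + B \<le> M) \<and>
     (\<integral>\<^sup>+t\<in>{0<..<1}. (\<integral>\<^sup>+x\<in>\<Omega>. ennreal ((norm (grad (\<phi> t) x))\<^sup>2 + (\<phi> t x)\<^sup>2) \<partial>\<mu> t) \<partial>lborel) < \<infinity>"


section \<open>The cone\<close>

text \<open>A vector field on the cone maps a point \<open>(x, r)\<close>, \<open>r > 0\<close>, to the pair \<open>(a, b)\<close> that stands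
  for \<open>a + b \<partial>\<^sub>r\<close>.\<close>

type_synonym 'a cone_field = "'a \<times> real \<Rightarrow> 'a \<times> real"

definition cone_connection ::
  "'a::euclidean_space cone_field \<Rightarrow> 'a cone_field \<Rightarrow> 'a cone_field" where
  "cone_connection W Z = (\<lambda>(x, r).
    (let a = fst (W (x, r)); b = snd (W (x, r)); c = (\<lambda>y s. fst (Z (y, s))); d = (\<lambda>y s. snd (Z (y, s))) in
     (frechet_derivative (\<lambda>y. c y r) (at x) a + b *\<^sub>R vector_derivative (\<lambda>s. c x s) (at r)
        + (b / r) *\<^sub>R c x r + (d x r / r) *\<^sub>R a,
      a \<bullet> grad (\<lambda>y. d y r) x + b * vector_derivative (\<lambda>s. d x s) (at r) - r * (a \<bullet> c x r))))"

definition tangent_lift :: "'a hk_field \<Rightarrow> 'a cone_field" where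
  "tangent_lift u = (\<lambda>(x, r). (fst (u x), 2 * snd (u x) * r))"

text \<open>The tangent projection for a measure \<open>(x \<mapsto> (x, r x))\<^sub># \<eta>\<close>; it depends on the measure only
  through the radius function \<open>r\<close>.\<close>

definition tangent_proj :: "('a \<Rightarrow> real) \<Rightarrow> ('a::euclidean_space) cone_field \<Rightarrow> 'a hk_field" where
  "tangent_proj r Z x = (fst (Z (x, r x)), snd (Z (x, r x)) / (2 * r x))"

text \<open>The time derivative is taken in each of the two components.\<close>

definition W2_total_deriv ::
  "(real \<Rightarrow> 'a::euclidean_space cone_field) \<Rightarrow> (real \<Rightarrow> 'a cone_field) \<Rightarrow> real \<Rightarrow> 'a cone_field" where
  "W2_total_deriv V Z t p =
     (vector_derivative (\<lambda>s. fst (Z s p)) (at t), vector_derivative (\<lambda>s. snd (Z s p)) (at t))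
     + cone_connection (V t) (Z t) p"

text \<open>The deterministic isometric lift \<open>\<Lambda>\<close> of \<open>\<mu>\<close> with its flow \<open>X\<close> and radius function \<open>r\<close>. The flow
  equation is in integrated form, as the velocity need not be continuous in time; it starts from
  points of \<open>\<Gamma>\<close>, where \<open>\<mu> 0\<close> is supported. The equation for \<open>r t\<close> determines it on \<open>X t ` \<Gamma>\<close> only,
  so that \<open>r t > 0\<close>, as needed for \<open>(x, r t x)\<close> to be a point of the cone, is stated separately.\<close>

definition deterministic_lift ::
  "'a::euclidean_space set \<Rightarrow> 'a set \<Rightarrow> (real \<Rightarrow> 'a measure) \<Rightarrow> (real \<Rightarrow> 'a \<Rightarrow> real) \<Rightarrow>
   (real \<Rightarrow> 'a \<Rightarrow> 'a) \<Rightarrow> (real \<Rightarrow> 'a \<Rightarrow> real) \<Rightarrow> (real \<Rightarrow> ('a \<times> real) measure) \<Rightarrow> bool" where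
  "deterministic_lift \<Omega> \<Gamma> \<mu> \<phi> X r \<Lambda> \<longleftrightarrow>
     (\<forall>t\<in>{0..1}. X t \<in> borel_measurable (\<mu> 0) \<and> r t \<in> borel_measurable borel) \<and>
     (\<forall>x\<in>\<Gamma>. X 0 x = x) \<and>
     (\<forall>t\<in>{0..1}. \<forall>x\<in>\<Gamma>. X t x \<in> \<Omega> \<and>
        ((\<lambda>s. grad (\<phi> s) (X s x)) has_integral (X t x - X 0 x)) {0..t} \<and>
        (\<lambda>s. \<phi> s (X s x)) integrable_on {0..t} \<and>
        r t (X t x) = exp (2 * integral {0..t} (\<lambda>s. \<phi> s (X s x)))) \<and>
     (\<forall>t\<in>{0..1}. \<forall>x\<in>\<Omega>. r t x > 0) \<and>
     (\<forall>t\<in>{0..1}. \<Lambda> t = distr (distr (\<mu> 0) borel (X t)) borel (\<lambda>x. (x, r t x)))"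

definition pullback_connection ::
  "'a::euclidean_space set \<Rightarrow> (real \<Rightarrow> 'a measure) \<Rightarrow> (real \<Rightarrow> 'a \<Rightarrow> real) \<Rightarrow> (real \<Rightarrow> 'a \<Rightarrow> real) \<Rightarrow>
   (real \<Rightarrow> 'a hk_field) \<Rightarrow> real \<Rightarrow> 'a hk_field" where
  "pullback_connection U \<mu> r \<phi> u t =
     HK_proj U (\<mu> t) (tangent_proj (r t)
       (W2_total_deriv (\<lambda>s. tangent_lift (grad_field (\<phi> s))) (\<lambda>s. tangent_lift (u s)) t))"

end

theory Submission
  imports Defs
begin

text \<open>Both connections are \<open>HK_proj\<close> of a field, and the two fields agree before
  projection. With W the lift of (\<nabla>\<phi>, \<phi>) and Z the lift of (\<nabla>\<psi>,
  \<psi>), the radial coefficients are 2\<phi>r and 2\<psi>r. In the horizontal component the cone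
  terms (b/r)c and (d/r)a become 2\<phi>\<nabla>\<psi> and 2\<psi>\<nabla>\<phi>. The radial
  component is 2r \<partial>_t\<psi> + 2r\<langle>\<nabla>\<phi>,\<nabla>\<psi>\<rangle> +
  4r\<phi>\<psi> - r\<langle>\<nabla>\<phi>,\<nabla>\<psi>\<rangle>, and division by 2r gives the HK
  expression. This is \<open>tangent_proj_W2_total_deriv\<close>; it holds at every point of
  \<Omega>, which carries \<mu>_t. Agreement almost everywhere passes through the projection by
  \<open>HK_proj_AE_cong\<close>, because square integrability and orthogonality depend on the class
  of a field only.\<close>

text \<open>The preimages of a set under f and g differ only inside a null set, all of whose subsets
  are measurable in the completion. This is what lets measurability of a representative follow from
  that of its class.\<close>

lemma measurable_completion_AE_cong:
  assumes f: "f \<in> measurable (completion M) N" and g: "g \<in> space M \<rightarrow> space N"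
    and eq: "AE x in M. f x = g x"
  shows "g \<in> measurable (completion M) N"
proof (rule measurableI)
  fix A assume A: "A \<in> sets N"
  obtain E where E: "{x \<in> space M. f x \<noteq> g x} \<subseteq> E" "E \<in> null_sets M"
    using eq unfolding eventually_ae_filter by blast
  have sub: "{x \<in> space M. g x \<in> A \<and> f x \<noteq> g x} \<in> sets (completion M)"
    "{x \<in> space M. f x \<noteq> g x} \<in> sets (completion M)"
    by (rule sets_completionI_sub[OF E(2)], use E(1) in blast)+
  have "f -` A \<inter> space (completion M) \<in> sets (completion M)"
    using f A by (rule measurable_sets)
  then have "(f -` A \<inter> space (completion M) - {x \<in> space M. f x \<noteq> g x}) \<union>
      {x \<in> space M. g x \<in> A \<and> f x \<noteq> g x} \<in> sets (completion M)"
    using sub by blast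
  also have "(f -` A \<inter> space (completion M) - {x \<in> space M. f x \<noteq> g x}) \<union>
      {x \<in> space M. g x \<in> A \<and> f x \<noteq> g x} = g -` A \<inter> space (completion M)"
    by auto
  finally show "g -` A \<inter> space (completion M) \<in> sets (completion M)" .
qed (use g in auto)

lemma borel_measurable_components:
  fixes f :: "'c \<Rightarrow> 'a::euclidean_space \<times> 'b::euclidean_space"
  assumes "f \<in> borel_measurable M"
  shows "(\<lambda>x. fst (f x)) \<in> borel_measurable M" "(\<lambda>x. snd (f x)) \<in> borel_measurable M"
  by (rule borel_measurable_continuous_on[OF _ assms], simp add: continuous_on_fst continuous_on_id)
    (rule borel_measurable_continuous_on[OF _ assms], simp add: continuous_on_snd continuous_on_id)

lemma HK_L2_AE_cong:
  assumes f: "f \<in> HK_L2 \<mu>" and eq: "AE x in \<mu>. f x = g x"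
  shows "g \<in> HK_L2 \<mu>"
proof -
  have g: "g \<in> borel_measurable (completion \<mu>)"
    by (rule measurable_completion_AE_cong[OF _ _ eq]) (use f in \<open>auto simp: HK_L2_def\<close>)
  have meas: "(\<lambda>x. (norm (fst (g x)))\<^sup>2) \<in> borel_measurable (completion \<mu>)"
    "(\<lambda>x. (snd (g x))\<^sup>2) \<in> borel_measurable (completion \<mu>)"
    using borel_measurable_components[OF g] by simp_all
  have eq': "AE x in completion \<mu>. f x = g x"
    using eq by (rule AE_completion)
  have int: "integrable (completion \<mu>) (\<lambda>x. (norm (fst (f x)))\<^sup>2)"
    "integrable (completion \<mu>) (\<lambda>x. (snd (f x))\<^sup>2)"
    using f by (simp_all add: HK_L2_def)
  have "integrable (completion \<mu>) (\<lambda>x. (norm (fst (g x)))\<^sup>2)"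
    by (rule integrable_cong_AE_imp[OF int(1) meas(1)]) (use eq' in eventually_elim, simp)
  moreover have "integrable (completion \<mu>) (\<lambda>x. (snd (g x))\<^sup>2)"
    by (rule integrable_cong_AE_imp[OF int(2) meas(2)]) (use eq' in eventually_elim, simp)
  ultimately show ?thesis
    using g by (simp add: HK_L2_def)
qed

text \<open>The candidate w is kept: f enters its characterization only through membership in
  \<open>HK_L2\<close> and through integrals against tangent fields, and neither sees a null
  set.\<close>

lemma HK_projection_of_AE_cong:
  assumes f: "HK_projection_of U \<mu> f w" and eq: "AE x in \<mu>. f x = g x"
  shows "HK_projection_of U \<mu> g w"
proof -
  have fL: "f \<in> HK_L2 \<mu>" and gL: "g \<in> HK_L2 \<mu>" and w: "w \<in> HK_tangent U \<mu>"
    using f HK_L2_AE_cong[OF _ eq] by (auto simp: HK_projection_of_def)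
  have "f \<in> borel_measurable (completion \<mu>)" "g \<in> borel_measurable (completion \<mu>)"
    "w \<in> borel_measurable (completion \<mu>)"
    using fL gL w by (auto simp: HK_L2_def HK_tangent_def)
  \<comment> \<open>Equality of the Bochner integrals of a.e. equal functions requires both
    integrands to be measurable, hence the split into components.\<close>
  note [measurable] = this[THEN borel_measurable_components(1)] this[THEN borel_measurable_components(2)]
  have eq': "AE x in completion \<mu>. f x = g x"
    using eq by (rule AE_completion)
  have "HK_inner \<mu> (\<lambda>x. g x - w x) z = HK_inner \<mu> (\<lambda>x. f x - w x) z" if "z \<in> HK_tangent U \<mu>" for z
  proof -
    have "z \<in> borel_measurable (completion \<mu>)"
      using that by (auto simp: HK_L2_def HK_tangent_def)
    note [measurable] = borel_measurable_components[OF this]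
    have "AE x in completion \<mu>. fst (g x - w x) \<bullet> fst (z x) + 4 * snd (g x - w x) * snd (z x) =
        fst (f x - w x) \<bullet> fst (z x) + 4 * snd (f x - w x) * snd (z x)"
      using eq' by eventually_elim simp
    then show ?thesis
      unfolding HK_inner_def fst_diff snd_diff by (rule integral_cong_AE[rotated 2]) measurable
  qed
  then show ?thesis
    using f gL by (simp add: HK_projection_of_def)
qed

text \<open>By symmetry the two projection predicates are equal, so \<open>SOME\<close> picks the
  same function for both: the conclusion is equality everywhere, not just almost everywhere.\<close>

lemma HK_proj_AE_cong:
  assumes "AE x in \<mu>. f x = g x"
  shows "HK_proj U \<mu> f = HK_proj U \<mu> g"
proof -
  have "AE x in \<mu>. g x = f x"
    using assms by (simp add: eq_commute)
  then have "HK_projection_of U \<mu> f = HK_projection_of U \<mu> g"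
    using HK_projection_of_AE_cong[OF _ assms] HK_projection_of_AE_cong by blast
  then show ?thesis
    by (simp add: HK_proj_def)
qed

lemma grad_eqI:
  assumes "GDERIV f x :> D"
  shows "grad f x = D"
  unfolding grad_def
proof (rule the_equality, fact assms)
  fix E assume "GDERIV f x :> E"
  with assms have "(\<lambda>h. h \<bullet> E) = (\<lambda>h. h \<bullet> D)"
    unfolding gderiv_def by (rule has_derivative_unique[rotated])
  then show "E = D"
    by (simp add: fun_eq_iff vector_eq_ldot)
qed

text \<open>Riesz representation in coordinates: the derivative L is the inner product with the
  vector whose i-th coordinate is L i.\<close>

lemma gderiv_grad:
  assumes "f differentiable (at x)"
  shows "GDERIV f x :> grad f x"
proof -
  obtain L where L: "(f has_derivative L) (at x)"
    using assms by (auto simp: differentiable_def)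
  interpret bounded_linear L
    using L by (rule has_derivative_bounded_linear)
  have "L = (\<lambda>h. h \<bullet> (\<Sum>i\<in>Basis. L i *\<^sub>R i))"
  proof
    fix h
    have "L h = L (\<Sum>i\<in>Basis. (h \<bullet> i) *\<^sub>R i)"
      by (simp add: euclidean_representation)
    also have "\<dots> = h \<bullet> (\<Sum>i\<in>Basis. L i *\<^sub>R i)"
      by (simp add: sum scaleR inner_sum_right mult.commute)
    finally show "L h = h \<bullet> (\<Sum>i\<in>Basis. L i *\<^sub>R i)" .
  qed
  with L have "GDERIV f x :> (\<Sum>i\<in>Basis. L i *\<^sub>R i)"
    unfolding gderiv_def by metis
  with grad_eqI[OF this] show ?thesis
    by simp
qed

lemma grad_cmult:
  assumes "f differentiable (at x)"
  shows "grad (\<lambda>y. c * f y) x = c *\<^sub>R grad f x"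
proof (rule grad_eqI)
  show "GDERIV (\<lambda>y. c * f y) x :> c *\<^sub>R grad f x"
    using gderiv_grad[OF assms] unfolding gderiv_def
    by (auto dest: has_derivative_mult_right[where x = c])
qed

text \<open>The factor \<open>2\<close> and the radius cancel in the fibre component, where the Christoffel term
  \<open>- r \<langle>a, c\<rangle>\<close> of the cone removes half of the transport term.\<close>

lemma tangent_proj_W2_total_deriv:
  assumes R: "R x > 0" and diff_x: "\<psi> t differentiable (at x)"
    and diff_t: "(\<lambda>s. \<psi> s x) differentiable (at t)"
  shows "tangent_proj R (W2_total_deriv (\<lambda>s. tangent_lift (grad_field (\<phi> s)))
      (\<lambda>s. tangent_lift (grad_field (\<psi> s))) t) x =
    (vector_derivative (\<lambda>s. grad (\<psi> s) x) (at t)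
       + frechet_derivative (grad (\<psi> t)) (at x) (grad (\<phi> t) x)
       + (2 * \<phi> t x) *\<^sub>R grad (\<psi> t) x + (2 * \<psi> t x) *\<^sub>R grad (\<phi> t) x,
     vector_derivative (\<lambda>s. \<psi> s x) (at t) + (1 / 2) * (grad (\<psi> t) x \<bullet> grad (\<phi> t) x)
       + 2 * \<phi> t x * \<psi> t x)"
proof -
  \<comment> \<open>All derivatives are taken at a fixed cone point (x, r) and evaluated at r =
    \<open>R x\<close> afterwards. So \<open>R x\<close> is a constant in the time and space
    derivatives, and the radius function itself is never differentiated.\<close>
  have time: "vector_derivative (\<lambda>s. 2 * \<psi> s x * R x) (at t) =
      2 * vector_derivative (\<lambda>s. \<psi> s x) (at t) * R x"
  proof (rule vector_derivative_at)
    have "((\<lambda>s. \<psi> s x) has_vector_derivative vector_derivative (\<lambda>s. \<psi> s x) (at t)) (at t)"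
      using diff_t by (simp add: vector_derivative_works)
    from has_vector_derivative_scaleR[OF DERIV_const[of "2 * R x"] this]
    show "((\<lambda>s. 2 * \<psi> s x * R x) has_vector_derivative
      2 * vector_derivative (\<lambda>s. \<psi> s x) (at t) * R x) (at t)"
      by (simp add: mult_ac)
  qed
  have space: "grad (\<lambda>y. 2 * \<psi> t y * R x) x = (2 * R x) *\<^sub>R grad (\<psi> t) x"
    using grad_cmult[OF diff_x, of "2 * R x"] by (simp add: mult_ac)
  have fibre: "vector_derivative (\<lambda>s. 2 * \<psi> t x * s) (at (R x)) = 2 * \<psi> t x"
    by (rule vector_derivative_at)
      (auto intro!: derivative_eq_intros simp: has_real_derivative_iff_has_vector_derivative[symmetric])
  \<comment> \<open>The terms with \<partial>_t\<nabla>\<psi> and D\<nabla>\<psi> appear verbatim on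
    both sides and are carried along unevaluated; the horizontal part of the lift is constant in r,
    so its radial derivative vanishes.\<close>
  show ?thesis
    using R
    by (simp add: tangent_proj_def W2_total_deriv_def cone_connection_def tangent_lift_def
        grad_field_def Let_def time space fibre inner_commute[of "grad (\<phi> t) x"])
      (simp add: field_simps)
qed

theorem proposition4p10:
  fixes \<Omega> U \<Gamma> :: "'a::euclidean_space set"
    and \<mu> :: "real \<Rightarrow> 'a measure"
    and \<phi> \<psi> :: "real \<Rightarrow> 'a \<Rightarrow> real"
    and X :: "real \<Rightarrow> 'a \<Rightarrow> 'a"
    and r :: "real \<Rightarrow> 'a \<Rightarrow> real"
    and \<Lambda> :: "real \<Rightarrow> ('a \<times> real) measure"
  assumes "HK_setting \<Omega> U \<Gamma>"
    and "admissible_HK_geodesic \<Omega> U \<Gamma> \<mu> \<phi>"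
    and "deterministic_lift \<Omega> \<Gamma> \<mu> \<phi> X r \<Lambda>"
    and "C21_on \<Omega> \<psi>"
    and "\<forall>t\<in>{0<..<1}. grad_field (\<psi> t) \<in> HK_tangent U (\<mu> t)"
  shows "\<forall>t\<in>{0<..<1}. AE x in \<mu> t.
    pullback_connection U \<mu> r \<phi> (\<lambda>s. grad_field (\<psi> s)) t x =
    HK_cov_deriv U \<mu> \<phi> (\<lambda>s. grad_field (\<psi> s)) t x"
proof
  fix t :: real assume t: "t \<in> {0<..<1}"
  let ?c = "\<lambda>x. (vector_derivative (\<lambda>s. grad (\<psi> s) x) (at t)
       + frechet_derivative (grad (\<psi> t)) (at x) (grad (\<phi> t) x)
       + (2 * \<phi> t x) *\<^sub>R grad (\<psi> t) x + (2 * \<psi> t x) *\<^sub>R grad (\<phi> t) x,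
     vector_derivative (\<lambda>s. \<psi> s x) (at t) + (1 / 2) * (grad (\<psi> t) x \<bullet> grad (\<phi> t) x)
       + 2 * \<phi> t x * \<psi> t x)"
  have "\<mu> t \<in> finite_measures \<Omega>"
    using assms(2) t by (auto simp: admissible_HK_geodesic_def const_speed_HK_geodesic_def)
  then have \<Omega>: "AE x in \<mu> t. x \<in> \<Omega>"
    by (simp add: finite_measures_def)
  \<comment> \<open>On \<Omega> the radius is positive, so the division by 2r is legitimate, and
    \<psi> has the first derivatives in space and time that the computation uses.\<close>
  have "tangent_proj (r t) (W2_total_deriv (\<lambda>s. tangent_lift (grad_field (\<phi> s)))
      (\<lambda>s. tangent_lift (grad_field (\<psi> s))) t) x = ?c x" if x: "x \<in> \<Omega>" for x
  proof (rule tangent_proj_W2_total_deriv)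
    show "r t x > 0"
      using assms(3) t x by (simp add: deterministic_lift_def)
    show "\<psi> t differentiable (at x)" "(\<lambda>s. \<psi> s x) differentiable (at t)"
      using assms(4) t x unfolding C21_on_def by blast+
  qed
  with \<Omega> have "AE x in \<mu> t. tangent_proj (r t) (W2_total_deriv (\<lambda>s. tangent_lift (grad_field (\<phi> s)))
      (\<lambda>s. tangent_lift (grad_field (\<psi> s))) t) x = ?c x"
    by (rule eventually_mono)
  \<comment> \<open>What remains is unfolding: the right-hand field is the argument of
    \<open>HK_proj\<close> in \<open>HK_cov_deriv\<close> with v = \<nabla>\<psi> and \<beta> =
    \<psi>.\<close>
  from HK_proj_AE_cong[OF this]
  have "pullback_connection U \<mu> r \<phi> (\<lambda>s. grad_field (\<psi> s)) t =
      HK_cov_deriv U \<mu> \<phi> (\<lambda>s. grad_field (\<psi> s)) t"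
    by (simp add: pullback_connection_def HK_cov_deriv_def grad_field_def Let_def)
  then show "AE x in \<mu> t. pullback_connection U \<mu> r \<phi> (\<lambda>s. grad_field (\<psi> s)) t x =
      HK_cov_deriv U \<mu> \<phi> (\<lambda>s. grad_field (\<psi> s)) t x"
    by simp
qed

end
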